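(* Let $U_9=\{L(\alpha)\in CE(\mu_8): b_{1,6}=b_{1,4}=0,\ b_{1,2}\neq0,\ b_{1,1}\neq0\}$, and for $\alpha=(b_{0,0},b_{0,1},b_{1,1},b_{1,2},b_{1,4},b_{1,6})$ put $\Delta=b_{0,1}^2-4b_{0,0}b_{1,1}$ (and $\Delta'=b_{0,1}'^2-4b_{0,0}'b_{1,1}'$ for $\alpha'$). (1) Two algebras $L(\alpha)$ and $L(\alpha')$ from $U_9$ are isomorphic if and only if $$\left(\frac{b_{1,2}}{b_{1,1}}\right)^{12}\Delta=\left(\frac{b_{1,2}'}{b_{1,1}'}\right)^{12}\Delta'.$$ (2) For any $\lambda\in\mathbb{C}$ there exists $L(\alpha)\in U_9$ with $\left(\frac{b_{1,2}}{b_{1,1}}\right)^{12}\Delta=\lambda$. Then the algebras from $U_9$ can be parameterized as $L(\lambda,0,1,1,0,0)$, $\lambda\in\mathbb{C}$; that is, every algebra in $U_9$ is isomorphic to $L(\lambda,0,1,1,0,0)$ for some $\lambda\in\mathbb{C}$.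
   Context: A Leibniz algebra over $\mathbb{C}$ is a complex vector space with a bilinear bracket satisfying $[x,[y,z]]=[[x,y],z]-[[x,z],y]$. $CE(\mu_8)$ (one-dimensional Leibniz central extensions of the 8-dimensional naturally graded filiform Lie algebra $\mu_8$) is the class of the 9-dimensional complex Leibniz algebras $L(\alpha)$, $\alpha=(b_{0,0},b_{0,1},b_{1,1},b_{1,2},b_{1,4},b_{1,6})\in\mathbb{C}^6$, with basis $e_0,\dots,e_8$ and brackets $[e_i,e_0]=e_{i+1}$ ($1\le i\le 7$), $[e_0,e_i]=-e_{i+1}$ ($2\le i\le 7$), $[e_0,e_0]=b_{0,0}e_8$, $[e_0,e_1]=-e_2+b_{0,1}e_8$, $[e_1,e_1]=b_{1,1}e_8$, $[e_1,e_2]=-[e_2,e_1]=b_{1,2}e_8$, $[e_1,e_4]=-[e_4,e_1]=b_{1,4}e_8$, $[e_2,e_3]=-[e_3,e_2]=-b_{1,4}e_8$, $[e_1,e_6]=-[e_6,e_1]=b_{1,6}e_8$, $[e_2,e_5]=-[e_5,e_2]=-b_{1,6}e_8$, $[e_3,e_4]=-[e_4,e_3]=b_{1,6}e_8$, all other brackets of basis vectors being zero. Isomorphic means isomorphic as Leibniz algebras. *)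

theory Defs
  imports "HOL-Analysis.Analysis"
begin

text \<open>
  Right Leibniz algebras over the complex numbers. The scalar multiplication is a parameter because
  \<open>complex ^ 9\<close> carries its complex structure through \<open>(*s)\<close>, not through a type class.
\<close>

locale leibniz_algebra = vector_space scale
  for scale :: "complex \<Rightarrow> 'v::ab_group_add \<Rightarrow> 'v" +
  fixes bracket :: "'v \<Rightarrow> 'v \<Rightarrow> 'v"
  assumes linear_left: "Vector_Spaces.linear scale scale (\<lambda>x. bracket x y)"
    and linear_right: "Vector_Spaces.linear scale scale (\<lambda>y. bracket x y)"
    and leibniz: "bracket x (bracket y z) = bracket (bracket x y) z - bracket (bracket x z) y"

definition leibniz_isomorphic ::
  "(complex \<Rightarrow> 'v::ab_group_add \<Rightarrow> 'v) \<Rightarrow> ('v \<Rightarrow> 'v \<Rightarrow> 'v) \<Rightarrow>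
   (complex \<Rightarrow> 'w::ab_group_add \<Rightarrow> 'w) \<Rightarrow> ('w \<Rightarrow> 'w \<Rightarrow> 'w) \<Rightarrow> bool" where
  "leibniz_isomorphic s1 br1 s2 br2 \<longleftrightarrow>
     leibniz_algebra s1 br1 \<and> leibniz_algebra s2 br2 \<and>
     (\<exists>f. Vector_Spaces.linear s1 s2 f \<and> bij f \<and> (\<forall>x y. f (br1 x y) = br2 (f x) (f y)))"

datatype ce_param = CE_Param
  (b00: complex) (b01: complex) (b11: complex) (b12: complex) (b14: complex) (b16: complex)

text \<open>
  The elements of the index type \<open>9\<close> are the residues \<open>0, \<dots>, 8\<close>, so
  \<open>e 0, \<dots>, e 8\<close> is the standard basis. (Arguments beyond \<open>8\<close> would wrap around, but do not
  occur below.)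
\<close>

definition e :: "nat \<Rightarrow> complex ^ 9" where
  "e i = axis (of_nat i) 1"

definition basis_bracket :: "ce_param \<Rightarrow> nat \<Rightarrow> nat \<Rightarrow> complex ^ 9" where
  "basis_bracket \<alpha> i j =
    (if 1 \<le> i \<and> i \<le> 7 \<and> j = 0 then e (i + 1)
     else if i = 0 \<and> 2 \<le> j \<and> j \<le> 7 then - e (j + 1)
     else if (i, j) = (0, 0) then b00 \<alpha> *s e 8
     else if (i, j) = (0, 1) then - e 2 + b01 \<alpha> *s e 8
     else if (i, j) = (1, 1) then b11 \<alpha> *s e 8
     else if (i, j) = (1, 2) then b12 \<alpha> *s e 8
     else if (i, j) = (2, 1) then - (b12 \<alpha> *s e 8)
     else if (i, j) = (1, 4) then b14 \<alpha> *s e 8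
     else if (i, j) = (4, 1) then - (b14 \<alpha> *s e 8)
     else if (i, j) = (2, 3) then - (b14 \<alpha> *s e 8)
     else if (i, j) = (3, 2) then b14 \<alpha> *s e 8
     else if (i, j) = (1, 6) then b16 \<alpha> *s e 8
     else if (i, j) = (6, 1) then - (b16 \<alpha> *s e 8)
     else if (i, j) = (2, 5) then - (b16 \<alpha> *s e 8)
     else if (i, j) = (5, 2) then b16 \<alpha> *s e 8
     else if (i, j) = (3, 4) then b16 \<alpha> *s e 8
     else if (i, j) = (4, 3) then - (b16 \<alpha> *s e 8)
     else 0)"

text \<open>
  Every \<open>L \<alpha>\<close> lives on the same vector space, so the algebra is identified with its bracket.
\<close>

definition L :: "ce_param \<Rightarrow> complex ^ 9 \<Rightarrow> complex ^ 9 \<Rightarrow> complex ^ 9" where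
  "L \<alpha> x y = (\<Sum>i\<le>8. \<Sum>j\<le>8. (x $ of_nat i * y $ of_nat j) *s basis_bracket \<alpha> i j)"

definition CE_mu8 :: "(complex ^ 9 \<Rightarrow> complex ^ 9 \<Rightarrow> complex ^ 9) set" where
  "CE_mu8 = range L"

definition U9 :: "(complex ^ 9 \<Rightarrow> complex ^ 9 \<Rightarrow> complex ^ 9) set" where
  "U9 = {L \<alpha> |\<alpha>. L \<alpha> \<in> CE_mu8 \<and> b16 \<alpha> = 0 \<and> b14 \<alpha> = 0 \<and> b12 \<alpha> \<noteq> 0 \<and> b11 \<alpha> \<noteq> 0}"

definition Delta :: "ce_param \<Rightarrow> complex" where
  "Delta \<alpha> = (b01 \<alpha>)\<^sup>2 - 4 * b00 \<alpha> * b11 \<alpha>"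

abbreviation isomorphic_C9 :: "(complex ^ 9 \<Rightarrow> complex ^ 9 \<Rightarrow> complex ^ 9) \<Rightarrow>
    (complex ^ 9 \<Rightarrow> complex ^ 9 \<Rightarrow> complex ^ 9) \<Rightarrow> bool" (infix "\<cong>\<^sub>L" 50) where
  "A \<cong>\<^sub>L B \<equiv> leibniz_isomorphic (*s) A (*s) B"

lemma L_bracket_basis:
  assumes "i \<le> 8" "j \<le> 8"
  shows "L \<alpha> (e i) (e j) = basis_bracket \<alpha> i j"
proof -
  have *: "e k $ (of_nat l :: 9) = (if k = l then 1 else 0)" if "k \<le> 8" "l \<le> 8" for k l
  proof -
    have "k \<in> {0,1,2,3,4,5,6,7,8}" "l \<in> {0,1,2,3,4,5,6,7,8}" using that by auto
    then show ?thesis by (auto simp: e_def axis_def)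
  qed
  have "L \<alpha> (e i) (e j) = (\<Sum>k\<le>8. \<Sum>l\<le>8. if l = j then (if k = i then basis_bracket \<alpha> k l else 0) else 0)"
    unfolding L_def using assms by (intro sum.cong refl) (auto simp: *)
  also have "\<dots> = basis_bracket \<alpha> i j" using assms by simp
  finally show ?thesis .
qed

lemma L_linear:
  "Vector_Spaces.linear (*s) (*s) (\<lambda>x. L \<alpha> x y)"
  "Vector_Spaces.linear (*s) (*s) (\<lambda>y. L \<alpha> x y)"
  by (auto simp: Vector_Spaces.linear_iff vec.vector_space_axioms L_def vec_eq_iff
      algebra_simps sum.distrib sum_distrib_left)

lemma L_component:
  "L \<alpha> x y $ 0 = 0"
  "L \<alpha> x y $ 1 = 0"
  "L \<alpha> x y $ 2 = x $ 1 * y $ 0 - x $ 0 * y $ 1"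
  "L \<alpha> x y $ 3 = x $ 2 * y $ 0 - x $ 0 * y $ 2"
  "L \<alpha> x y $ 4 = x $ 3 * y $ 0 - x $ 0 * y $ 3"
  "L \<alpha> x y $ 5 = x $ 4 * y $ 0 - x $ 0 * y $ 4"
  "L \<alpha> x y $ 6 = x $ 5 * y $ 0 - x $ 0 * y $ 5"
  "L \<alpha> x y $ 7 = x $ 6 * y $ 0 - x $ 0 * y $ 6"
  "L \<alpha> x y $ 8 = x $ 7 * y $ 0 - x $ 0 * y $ 7
     + b00 \<alpha> * x $ 0 * y $ 0 + b01 \<alpha> * x $ 0 * y $ 1 + b11 \<alpha> * x $ 1 * y $ 1
     + b12 \<alpha> * (x $ 1 * y $ 2 - x $ 2 * y $ 1)
     + b14 \<alpha> * (x $ 1 * y $ 4 - x $ 4 * y $ 1 - x $ 2 * y $ 3 + x $ 3 * y $ 2)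
     + b16 \<alpha> * (x $ 1 * y $ 6 - x $ 6 * y $ 1 - x $ 2 * y $ 5 + x $ 5 * y $ 2
                + x $ 3 * y $ 4 - x $ 4 * y $ 3)"
proof -
  have A: "{..8::nat} = {0,1,2,3,4,5,6,7,8}" by auto
  have B: "L \<alpha> x y = (x $ 0 * y $ 0) *s (b00 \<alpha> *s e 8)
      + (x $ 0 * y $ 1) *s (- e 2 + b01 \<alpha> *s e 8) + (x $ 1 * y $ 1) *s (b11 \<alpha> *s e 8)
      + (\<Sum>i\<in>{1,2,3,4,5,6,7}. (x $ of_nat i * y $ 0) *s e (i + 1))
      + (\<Sum>i\<in>{2,3,4,5,6,7}. (x $ 0 * y $ of_nat i) *s - e (i + 1))
      + (x $ 1 * y $ 2 - x $ 2 * y $ 1) *s (b12 \<alpha> *s e 8)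
      + (x $ 1 * y $ 4 - x $ 4 * y $ 1 - x $ 2 * y $ 3 + x $ 3 * y $ 2) *s (b14 \<alpha> *s e 8)
      + (x $ 1 * y $ 6 - x $ 6 * y $ 1 - x $ 2 * y $ 5 + x $ 5 * y $ 2
         + x $ 3 * y $ 4 - x $ 4 * y $ 3) *s (b16 \<alpha> *s e 8)"
    unfolding L_def A
    by (simp add: basis_bracket_def) (simp add: vec_eq_iff algebra_simps)
  show
    "L \<alpha> x y $ 0 = 0"
    "L \<alpha> x y $ 1 = 0"
    "L \<alpha> x y $ 2 = x $ 1 * y $ 0 - x $ 0 * y $ 1"
    "L \<alpha> x y $ 3 = x $ 2 * y $ 0 - x $ 0 * y $ 2"
    "L \<alpha> x y $ 4 = x $ 3 * y $ 0 - x $ 0 * y $ 3"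
    "L \<alpha> x y $ 5 = x $ 4 * y $ 0 - x $ 0 * y $ 4"
    "L \<alpha> x y $ 6 = x $ 5 * y $ 0 - x $ 0 * y $ 5"
    "L \<alpha> x y $ 7 = x $ 6 * y $ 0 - x $ 0 * y $ 6"
    "L \<alpha> x y $ 8 = x $ 7 * y $ 0 - x $ 0 * y $ 7
       + b00 \<alpha> * x $ 0 * y $ 0 + b01 \<alpha> * x $ 0 * y $ 1 + b11 \<alpha> * x $ 1 * y $ 1
       + b12 \<alpha> * (x $ 1 * y $ 2 - x $ 2 * y $ 1)
       + b14 \<alpha> * (x $ 1 * y $ 4 - x $ 4 * y $ 1 - x $ 2 * y $ 3 + x $ 3 * y $ 2)
       + b16 \<alpha> * (x $ 1 * y $ 6 - x $ 6 * y $ 1 - x $ 2 * y $ 5 + x $ 5 * y $ 2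
                  + x $ 3 * y $ 4 - x $ 4 * y $ 3)"
    unfolding B by (simp_all add: e_def axis_def) (simp_all add: algebra_simps)?
qed

lemma forall_9:
  "(\<forall>k::9. P k) \<longleftrightarrow> P 0 \<and> P 1 \<and> P 2 \<and> P 3 \<and> P 4 \<and> P 5 \<and> P 6 \<and> P 7 \<and> P 8"
proof -
  have "k \<in> {0,1,2,3,4,5,6,7,8}" for k :: 9
  proof (cases k rule: bit1_cases)
    case (of_int z)
    then have "z \<in> {0,1,2,3,4,5,6,7,8}" by auto
    then show ?thesis using of_int by auto
  qed
  then have U: "(UNIV :: 9 set) = {0,1,2,3,4,5,6,7,8}" by (intro set_eqI) simp
  have "(\<forall>k. P k) \<longleftrightarrow> (\<forall>k\<in>UNIV. P k)" by simp
  also have "\<dots> \<longleftrightarrow> P 0 \<and> P 1 \<and> P 2 \<and> P 3 \<and> P 4 \<and> P 5 \<and> P 6 \<and> P 7 \<and> P 8"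
    unfolding U ball_simps by simp
  finally show ?thesis .
qed

lemma leibniz_algebra_L: "leibniz_algebra (*s) (L \<alpha>)"
proof (intro leibniz_algebra.intro vec.vector_space_axioms leibniz_algebra_axioms.intro)
  show "Vector_Spaces.linear (*s) (*s) (\<lambda>x. L \<alpha> x y)" for y by (rule L_linear)
  show "Vector_Spaces.linear (*s) (*s) (\<lambda>y. L \<alpha> x y)" for x by (rule L_linear)
  show "L \<alpha> x (L \<alpha> y z) = L \<alpha> (L \<alpha> x y) z - L \<alpha> (L \<alpha> x z) y" for x y z
    unfolding vec_eq_iff forall_9 by (simp add: L_component algebra_simps)
qed

end

theory Submission
  imports Defs
begin

text \<open>
  Write \<open>\<beta> = b12 / b11\<close>. An isomorphism \<open>f\<close> is determined by \<open>f e\<^sub>0 = p e\<^sub>0 + q e\<^sub>1 + \<dots>\<close> and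
  \<open>f e\<^sub>1\<close>. The relation \<open>[e\<^sub>1, e\<^sub>2] = b12 e\<^sub>8\<close> forces \<open>f e\<^sub>1 = r e\<^sub>1 + \<dots>\<close>, whence
  \<open>f e\<^sub>8 = p\<^sup>7 r e\<^sub>8\<close>. On the span of \<open>e\<^sub>0, e\<^sub>1\<close> the symmetric part of the bracket is a binary
  quadratic form with discriminant \<open>Delta\<close>, and comparing these forms gives
  \<open>p\<^sup>1\<^sup>2 Delta = Delta'\<close>, while comparing \<open>b11\<close> and \<open>b12\<close> gives \<open>\<beta> = p \<beta>'\<close>.
  Conversely, these relations can be solved for \<open>p, q, r\<close>.
\<close>

lemma e_nth:
  assumes "i \<le> 8" "j \<le> 8"
  shows "e i $ of_nat j = (if i = j then 1 else 0)"
proof -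
  have "i \<in> {0,1,2,3,4,5,6,7,8}" "j \<in> {0,1,2,3,4,5,6,7,8}" using assms by auto
  then show ?thesis by (auto simp: e_def axis_def)
qed

lemma basis_bracket_nth_8:
  "basis_bracket \<alpha> 0 0 $ 8 = b00 \<alpha>"
  "basis_bracket \<alpha> 0 1 $ 8 = b01 \<alpha>"
  "basis_bracket \<alpha> 1 1 $ 8 = b11 \<alpha>"
  "basis_bracket \<alpha> 1 2 $ 8 = b12 \<alpha>"
  "basis_bracket \<alpha> 1 4 $ 8 = b14 \<alpha>"
  "basis_bracket \<alpha> 1 6 $ 8 = b16 \<alpha>"
  using e_nth[of 8 8] e_nth[of 2 8] by (simp_all add: basis_bracket_def)

text \<open>Each parameter is the \<open>e 8\<close> coordinate of one bracket of basis vectors.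
  This matters because \<open>U9\<close> is a set of brackets: by its definition, membership of
  \<open>L \<alpha>\<close> only yields some parameter that satisfies the conditions, and
  injectivity identifies it with \<alpha>.\<close>

lemma inj_L: "inj L"
proof (rule injI)
  fix \<alpha> \<alpha>' assume "L \<alpha> = L \<alpha>'"
  then have "basis_bracket \<alpha> i j $ 8 = basis_bracket \<alpha>' i j $ 8" if "i \<le> 8" "j \<le> 8" for i j
    using that by (metis L_bracket_basis)
  from this[of 0 0] this[of 0 1] this[of 1 1] this[of 1 2] this[of 1 4] this[of 1 6]
  show "\<alpha> = \<alpha>'" by (intro ce_param.expand) (simp add: basis_bracket_nth_8[simplified])
qed

lemma L_in_U9_iff:
  "L \<alpha> \<in> U9 \<longleftrightarrow> b16 \<alpha> = 0 \<and> b14 \<alpha> = 0 \<and> b12 \<alpha> \<noteq> 0 \<and> b11 \<alpha> \<noteq> 0"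
  unfolding U9_def CE_mu8_def using inj_L by (auto dest: injD)

text \<open>The relations are the \<open>e 8\<close> coordinates of the images of [e0,e0], [e0,e1],
  [e1,e1] and [e1,e2]; the common factor \<open>p ^ 7 * r\<close> is the \<open>e 8\<close>
  coordinate of the image of \<open>e 8\<close>.\<close>

lemma isomorphic_necessary_relations:
  assumes iso: "L \<alpha> \<cong>\<^sub>L L \<alpha>'"
    and \<alpha>: "b16 \<alpha> = 0" "b14 \<alpha> = 0"
    and \<alpha>': "b16 \<alpha>' = 0" "b14 \<alpha>' = 0"
  obtains p q r where "p \<noteq> 0" "r \<noteq> 0"
    "b00 \<alpha> * (p ^ 7 * r) = b00 \<alpha>' * p\<^sup>2 + b01 \<alpha>' * p * q + b11 \<alpha>' * q\<^sup>2"
    "b01 \<alpha> * (p ^ 7 * r) = b01 \<alpha>' * p * r + 2 * b11 \<alpha>' * q * r"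
    "b11 \<alpha> * (p ^ 7 * r) = b11 \<alpha>' * r\<^sup>2"
    "b12 \<alpha> * (p ^ 7 * r) = b12 \<alpha>' * p * r\<^sup>2"
proof -
  from iso obtain f where lin: "Vector_Spaces.linear (*s) (*s) f" and "bij f"
    and hom: "\<And>x y. f (L \<alpha> x y) = L \<alpha>' (f x) (f y)"
    unfolding leibniz_isomorphic_def by blast
  interpret f: Vector_Spaces.linear "(*s)" "(*s)" f by (rule lin)
  have br: "f (basis_bracket \<alpha> i j) = L \<alpha>' (f (e i)) (f (e j))" if "i \<le> 8" "j \<le> 8" for i j
    using hom[of "e i" "e j"] L_bracket_basis[OF that] by simp
  define p q r s where "p = f (e 0) $ 0" and "q = f (e 0) $ 1" and "r = f (e 1) $ 1"
    and "s = f (e 1) $ 0"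
  have pq: "f (e 0) $ 0 = p" "f (e 0) $ 1 = q" "f (e 1) $ 1 = r" "f (e 1) $ 0 = s"
    by (simp_all add: p_def q_def r_def s_def)
  note pq = pq pq[simplified]
  have step: "f (e (Suc i)) = L \<alpha>' (f (e i)) (f (e 0))" if "1 \<le> i" "i \<le> 7" for i
    using br[of i 0] that by (simp add: basis_bracket_def)
  \<comment> \<open>\<open>D\<close> is the determinant of the map induced by \<open>f\<close>
    modulo the span of e2, ..., e8. Bracketing repeatedly with \<open>f (e 0)\<close> on the right
    then gives \<open>f (e i)\<close> the leading term \<open>D * p ^ (i - 2)\<close> at
    \<open>e i\<close>, with zeros before it.\<close>
  define D where "D = r * p - s * q"
  have f2: "f (e 2) $ 0 = 0" "f (e 2) $ 1 = 0" "f (e 2) $ 2 = D"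
    using step[of 1] by (simp_all add: L_component pq D_def numeral_2_eq_2[symmetric])
  have f3: "f (e 3) $ 0 = 0" "f (e 3) $ 1 = 0" "f (e 3) $ 2 = 0" "f (e 3) $ 3 = D * p"
    using step[of 2] by (simp_all add: L_component pq f2)
  have f4: "f (e 4) $ 0 = 0" "f (e 4) $ 1 = 0" "f (e 4) $ 2 = 0" "f (e 4) $ 3 = 0"
    "f (e 4) $ 4 = D * p ^ 2"
    using step[of 3] by (simp_all add: L_component pq f3 power2_eq_square)
  have f5: "f (e 5) $ 0 = 0" "f (e 5) $ 1 = 0" "f (e 5) $ 2 = 0" "f (e 5) $ 3 = 0"
    "f (e 5) $ 4 = 0" "f (e 5) $ 5 = D * p ^ 3"
    using step[of 4] by (simp_all add: L_component pq f4) (simp_all add: eval_nat_numeral)?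
  have f6: "f (e 6) $ 0 = 0" "f (e 6) $ 1 = 0" "f (e 6) $ 2 = 0" "f (e 6) $ 3 = 0"
    "f (e 6) $ 4 = 0" "f (e 6) $ 5 = 0" "f (e 6) $ 6 = D * p ^ 4"
    using step[of 5] by (simp_all add: L_component pq f5) (simp_all add: eval_nat_numeral)?
  have f7: "f (e 7) $ 0 = 0" "f (e 7) $ 1 = 0" "f (e 7) $ 2 = 0" "f (e 7) $ 3 = 0"
    "f (e 7) $ 4 = 0" "f (e 7) $ 5 = 0" "f (e 7) $ 6 = 0" "f (e 7) $ 7 = D * p ^ 5"
    using step[of 6] by (simp_all add: L_component pq f6) (simp_all add: eval_nat_numeral)?
  have f8: "f (e 8) $ 0 = 0" "f (e 8) $ 1 = 0" "f (e 8) $ 2 = 0" "f (e 8) $ 3 = 0"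
    "f (e 8) $ 4 = 0" "f (e 8) $ 5 = 0" "f (e 8) $ 6 = 0" "f (e 8) $ 7 = 0"
    "f (e 8) $ 8 = D * p ^ 6"
    using step[of 7] by (simp_all add: L_component pq f7 \<alpha>') (simp_all add: eval_nat_numeral)?
  have "e 8 \<noteq> 0" using e_nth[of 8 8] by auto
  then have "f (e 8) \<noteq> 0" using \<open>bij f\<close> f.zero by (metis bij_def injD)
  then have "D * p ^ 6 \<noteq> 0" unfolding vec_eq_iff forall_9 by (simp add: f8)
  then have D: "D \<noteq> 0" and p: "p \<noteq> 0" by auto
  \<comment> \<open>The left side is \<open>- s * D\<close>, whereas \<open>f (e 8)\<close> has no
    \<open>e 3\<close> coordinate.\<close>
  have "L \<alpha>' (f (e 1)) (f (e 2)) $ 3 = (b12 \<alpha> *s f (e 8)) $ 3"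
    using br[of 1 2] by (simp add: basis_bracket_def f.scale)
  then have s: "s = 0" using D by (simp add: L_component f2 f8 pq)
  then have r: "r \<noteq> 0" and f8': "f (e 8) $ 8 = p ^ 7 * r"
    using D f8(9) by (auto simp: D_def eval_nat_numeral)
  have "(b00 \<alpha> *s f (e 8)) $ 8 = L \<alpha>' (f (e 0)) (f (e 0)) $ 8"
    using br[of 0 0] by (simp add: basis_bracket_def f.scale)
  then have r00: "b00 \<alpha> * (p ^ 7 * r) = b00 \<alpha>' * p\<^sup>2 + b01 \<alpha>' * p * q + b11 \<alpha>' * q\<^sup>2"
    by (simp add: L_component f8' pq \<alpha>' power2_eq_square)
  have "(- f (e 2) + b01 \<alpha> *s f (e 8)) $ 8 = L \<alpha>' (f (e 0)) (f (e 1)) $ 8"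
    using br[of 0 1] by (simp add: basis_bracket_def f.scale f.diff)
  \<comment> \<open>The \<open>e 8\<close> coordinate of \<open>f (e 2)\<close> involves unknown
    coordinates of \<open>f (e 0)\<close> and \<open>f (e 1)\<close>. Adding [e0,e1] and [e1,e0]
    removes it: the antisymmetric terms cancel and only the symmetric part remains.\<close>
  moreover have "f (e 2) $ 8 = L \<alpha>' (f (e 1)) (f (e 0)) $ 8"
    using br[of 1 0] by (simp add: basis_bracket_def numeral_2_eq_2)
  ultimately have r01: "b01 \<alpha> * (p ^ 7 * r) = b01 \<alpha>' * p * r + 2 * b11 \<alpha>' * q * r"
    by (simp add: L_component f8' pq s \<alpha>' algebra_simps)
  have "(b11 \<alpha> *s f (e 8)) $ 8 = L \<alpha>' (f (e 1)) (f (e 1)) $ 8"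
    using br[of 1 1] by (simp add: basis_bracket_def f.scale)
  then have r11: "b11 \<alpha> * (p ^ 7 * r) = b11 \<alpha>' * r\<^sup>2"
    by (simp add: L_component f8' pq s \<alpha>' power2_eq_square)
  have "(b12 \<alpha> *s f (e 8)) $ 8 = L \<alpha>' (f (e 1)) (f (e 2)) $ 8"
    using br[of 1 2] by (simp add: basis_bracket_def f.scale)
  then have r12: "b12 \<alpha> * (p ^ 7 * r) = b12 \<alpha>' * p * r\<^sup>2"
    by (simp add: L_component f8' f2 pq s \<alpha>' D_def power2_eq_square ac_simps)
  show thesis using that[OF p r r00 r01 r11 r12] .
qed

lemma isomorphic_sufficient_relations:
  assumes nz: "p \<noteq> 0" "r \<noteq> 0"
    and \<alpha>: "b16 \<alpha> = 0" "b14 \<alpha> = 0"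
    and \<alpha>': "b16 \<alpha>' = 0" "b14 \<alpha>' = 0"
    and r00: "b00 \<alpha> * (p ^ 7 * r) = b00 \<alpha>' * p\<^sup>2 + b01 \<alpha>' * p * q + b11 \<alpha>' * q\<^sup>2"
    and r01: "b01 \<alpha> * (p ^ 7 * r) = b01 \<alpha>' * p * r + 2 * b11 \<alpha>' * q * r"
    and r11: "b11 \<alpha> * (p ^ 7 * r) = b11 \<alpha>' * r\<^sup>2"
    and r12: "b12 \<alpha> * (p ^ 7 * r) = b12 \<alpha>' * p * r\<^sup>2"
  shows "L \<alpha> \<cong>\<^sub>L L \<alpha>'"
proof -
  \<comment> \<open>Start from e0 -> p e0 + q e1 and e1 -> r e1, then bracket repeatedly on the
    right with the image of e0. The \<open>e 8\<close> corrections at e2 and e3 come from q [e1,e1]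
    and q [e2,e1]; none arise later, since [ei,e1] = 0 for i > 2.\<close>
  define f :: "complex ^ 9 \<Rightarrow> complex ^ 9" where
    "f x = (x $ 0) *s (p *s e 0 + q *s e 1) + (x $ 1) *s (r *s e 1)
      + (x $ 2) *s ((p * r) *s e 2 + (b11 \<alpha>' * q * r) *s e 8)
      + (x $ 3) *s ((p ^ 2 * r) *s e 3 - (b12 \<alpha>' * p * q * r) *s e 8)
      + (x $ 4 * p ^ 3 * r) *s e 4 + (x $ 5 * p ^ 4 * r) *s e 5 + (x $ 6 * p ^ 5 * r) *s e 6
      + (x $ 7 * p ^ 6 * r) *s e 7 + (x $ 8 * p ^ 7 * r) *s e 8" for x
  have f_nth: "f x $ 0 = p * x $ 0" "f x $ 1 = q * x $ 0 + r * x $ 1" "f x $ 2 = p * r * x $ 2"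
    "f x $ 3 = p ^ 2 * r * x $ 3" "f x $ 4 = p ^ 3 * r * x $ 4" "f x $ 5 = p ^ 4 * r * x $ 5"
    "f x $ 6 = p ^ 5 * r * x $ 6" "f x $ 7 = p ^ 6 * r * x $ 7"
    "f x $ 8 = p ^ 7 * r * x $ 8 + b11 \<alpha>' * q * r * x $ 2 - b12 \<alpha>' * p * q * r * x $ 3" for x
    unfolding f_def by (simp_all add: e_def axis_def algebra_simps)
  have lin: "Vector_Spaces.linear (*s) (*s) f"
    by (auto simp: Vector_Spaces.linear_iff vec.vector_space_axioms vec_eq_iff forall_9 f_nth
        algebra_simps)
  \<comment> \<open>The matrix of \<open>f\<close> is triangular with diagonal p, r, p r, ..., p^7
    r.\<close>
  have "x = 0" if "f x = 0" for x
    using that nz unfolding vec_eq_iff forall_9 f_nth by auto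
  then have inj: "inj f" by (simp add: vec.linear_inj_iff_eq_0[OF lin])
  then have "bij f" using vec.linear_injective_imp_surjective[OF lin] by (simp add: bij_def)
  moreover have "f (L \<alpha> x y) = L \<alpha>' (f x) (f y)" for x y
  proof -
    \<comment> \<open>Only this coordinate needs the four relations; the others agree identically in
      p, q, r.\<close>
    have "f (L \<alpha> x y) $ 8 = L \<alpha>' (f x) (f y) $ 8"
      unfolding f_nth L_component \<alpha> \<alpha>' using r00 r01 r11 r12 by algebra
    then show ?thesis
      unfolding vec_eq_iff forall_9 f_nth L_component by (simp add: algebra_simps eval_nat_numeral)
  qed
  ultimately show ?thesis
    unfolding leibniz_isomorphic_def using lin leibniz_algebra_L by blast
qed

lemma U9_isomorphic_iff:
  assumes "L \<alpha> \<in> U9" "L \<alpha>' \<in> U9"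
  shows "L \<alpha> \<cong>\<^sub>L L \<alpha>' \<longleftrightarrow>
    (b12 \<alpha> / b11 \<alpha>) ^ 12 * Delta \<alpha> = (b12 \<alpha>' / b11 \<alpha>') ^ 12 * Delta \<alpha>'"
proof
  note \<alpha> = assms(1)[unfolded L_in_U9_iff] and \<alpha>' = assms(2)[unfolded L_in_U9_iff]
  assume "L \<alpha> \<cong>\<^sub>L L \<alpha>'"
  then obtain p q r where pr: "p \<noteq> 0" "r \<noteq> 0"
    and r00: "b00 \<alpha> * (p ^ 7 * r) = b00 \<alpha>' * p\<^sup>2 + b01 \<alpha>' * p * q + b11 \<alpha>' * q\<^sup>2"
    and r01: "b01 \<alpha> * (p ^ 7 * r) = b01 \<alpha>' * p * r + 2 * b11 \<alpha>' * q * r"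
    and r11: "b11 \<alpha> * (p ^ 7 * r) = b11 \<alpha>' * r\<^sup>2"
    and r12: "b12 \<alpha> * (p ^ 7 * r) = b12 \<alpha>' * p * r\<^sup>2"
    using isomorphic_necessary_relations \<alpha> \<alpha>' by metis
  \<comment> \<open>By the first three relations, \<open>p ^ 7 * r\<close> times the form of
    \<alpha> is the form of \<alpha>' after the substitution (u, v) -> (p u, q u + r v), whose
    determinant is p r. The discriminant scales by the square of that determinant.\<close>
  have "Delta \<alpha> * (p ^ 7 * r)\<^sup>2 = (b01 \<alpha> * (p ^ 7 * r))\<^sup>2 - 4 * (b00 \<alpha> * (p ^ 7 * r)) * (b11 \<alpha> * (p ^ 7 * r))"
    by (simp add: Delta_def power2_eq_square algebra_simps)
  also have "\<dots> = Delta \<alpha>' * (p * r)\<^sup>2"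
    unfolding r00 r01 r11 by (simp add: Delta_def power2_eq_square algebra_simps)
  finally have "(Delta \<alpha> * p ^ 12) * (p * r)\<^sup>2 = Delta \<alpha>' * (p * r)\<^sup>2"
    by algebra
  then have \<Delta>: "Delta \<alpha>' = Delta \<alpha> * p ^ 12" using pr by simp
  have "b12 \<alpha> / b11 \<alpha> = (b12 \<alpha> * (p ^ 7 * r)) / (b11 \<alpha> * (p ^ 7 * r))" using pr by simp
  also have "\<dots> = p * (b12 \<alpha>' / b11 \<alpha>')" unfolding r11 r12 using pr by simp
  finally show "(b12 \<alpha> / b11 \<alpha>) ^ 12 * Delta \<alpha> = (b12 \<alpha>' / b11 \<alpha>') ^ 12 * Delta \<alpha>'"
    unfolding \<Delta> by (simp add: power_mult_distrib power_divide)
next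
  note \<alpha> = assms(1)[unfolded L_in_U9_iff] and \<alpha>' = assms(2)[unfolded L_in_U9_iff]
  assume inv: "(b12 \<alpha> / b11 \<alpha>) ^ 12 * Delta \<alpha> = (b12 \<alpha>' / b11 \<alpha>') ^ 12 * Delta \<alpha>'"
  \<comment> \<open>The value of \<open>p\<close> is forced by the quotient of the
    \<open>b12\<close> and \<open>b11\<close> relations; \<open>q\<close> and \<open>r\<close> then
    solve the \<open>b01\<close> and \<open>b11\<close> relations. The invariant is left to supply
    the \<open>b00\<close> relation.\<close>
  define p where "p = (b12 \<alpha> / b11 \<alpha>) / (b12 \<alpha>' / b11 \<alpha>')"
  define q where "q = (b01 \<alpha> * p ^ 7 - b01 \<alpha>' * p) / (2 * b11 \<alpha>')"
  define r where "r = b11 \<alpha> * p ^ 7 / b11 \<alpha>'"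
  have p: "p \<noteq> 0" and r: "r \<noteq> 0" using \<alpha> \<alpha>' by (simp_all add: p_def r_def)
  have q2: "2 * b11 \<alpha>' * q = b01 \<alpha> * p ^ 7 - b01 \<alpha>' * p" using \<alpha>' by (simp add: q_def)
  have r1: "b11 \<alpha>' * r = b11 \<alpha> * p ^ 7" using \<alpha>' by (simp add: r_def)
  have b: "b12 \<alpha> * b11 \<alpha>' = p * b12 \<alpha>' * b11 \<alpha>" using \<alpha> \<alpha>' by (simp add: p_def)
  have "b12 \<alpha> / b11 \<alpha> = p * (b12 \<alpha>' / b11 \<alpha>')" using \<alpha>' by (simp add: p_def)
  then have \<Delta>: "Delta \<alpha>' = Delta \<alpha> * p ^ 12"
    using inv \<alpha>' by (simp add: power_mult_distrib power_divide mult.commute)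
  have "b11 \<alpha>' * (b12 \<alpha> * p ^ 7) = b11 \<alpha>' * (b12 \<alpha>' * p * r)" using b r1 by algebra
  then have "b12 \<alpha> * p ^ 7 = b12 \<alpha>' * p * r" using \<alpha>' by simp
  then have r12: "b12 \<alpha> * (p ^ 7 * r) = b12 \<alpha>' * p * r\<^sup>2" by algebra
  \<comment> \<open>Completing the square turns the right side into (2 b11' q + b01' p)^2 - Delta'
    p^2, where primes refer to \<alpha>'; here \<open>q2\<close> and \<Delta> apply.\<close>
  have "4 * b11 \<alpha>' * (b00 \<alpha> * (p ^ 7 * r))
      = 4 * b11 \<alpha>' * (b00 \<alpha>' * p\<^sup>2 + b01 \<alpha>' * p * q + b11 \<alpha>' * q\<^sup>2)"
    using q2 r1 \<Delta>[unfolded Delta_def] by algebra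
  then have r00: "b00 \<alpha> * (p ^ 7 * r) = b00 \<alpha>' * p\<^sup>2 + b01 \<alpha>' * p * q + b11 \<alpha>' * q\<^sup>2"
    using \<alpha>' by simp
  have r01: "b01 \<alpha> * (p ^ 7 * r) = b01 \<alpha>' * p * r + 2 * b11 \<alpha>' * q * r" using q2 by algebra
  have r11: "b11 \<alpha> * (p ^ 7 * r) = b11 \<alpha>' * r\<^sup>2" using r1 by algebra
  show "L \<alpha> \<cong>\<^sub>L L \<alpha>'"
    using isomorphic_sufficient_relations[OF p r _ _ _ _ r00 r01 r11 r12] \<alpha> \<alpha>' by blast
qed

theorem proposition3p18:
  shows "(\<forall>\<alpha> \<alpha>'. L \<alpha> \<in> U9 \<longrightarrow> L \<alpha>' \<in> U9 \<longrightarrow>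
           (L \<alpha> \<cong>\<^sub>L L \<alpha>' \<longleftrightarrow>
            (b12 \<alpha> / b11 \<alpha>) ^ 12 * Delta \<alpha> = (b12 \<alpha>' / b11 \<alpha>') ^ 12 * Delta \<alpha>')) \<and>
         (\<forall>c. \<exists>\<alpha>. L \<alpha> \<in> U9 \<and> (b12 \<alpha> / b11 \<alpha>) ^ 12 * Delta \<alpha> = c) \<and>
         (\<forall>A\<in>U9. \<exists>c. A \<cong>\<^sub>L L (CE_Param c 0 1 1 0 0))"
proof (intro conjI allI impI ballI)
  fix \<alpha> \<alpha>' assume "L \<alpha> \<in> U9" "L \<alpha>' \<in> U9"
  then show "L \<alpha> \<cong>\<^sub>L L \<alpha>' \<longleftrightarrow>
      (b12 \<alpha> / b11 \<alpha>) ^ 12 * Delta \<alpha> = (b12 \<alpha>' / b11 \<alpha>') ^ 12 * Delta \<alpha>'"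
    by (rule U9_isomorphic_iff)
next
  fix c
  show "\<exists>\<alpha>. L \<alpha> \<in> U9 \<and> (b12 \<alpha> / b11 \<alpha>) ^ 12 * Delta \<alpha> = c"
    \<comment> \<open>The algebra L(c,0,1,1,0,0) has invariant -4c, hence the division by -4 here
      and in the choice of representative below.\<close>
    by (rule exI[of _ "CE_Param (- c / 4) 0 1 1 0 0"]) (simp add: L_in_U9_iff Delta_def)
next
  fix A assume A: "A \<in> U9"
  then obtain \<alpha> where \<alpha>: "A = L \<alpha>" unfolding U9_def by blast
  have "L (CE_Param (- ((b12 \<alpha> / b11 \<alpha>) ^ 12 * Delta \<alpha>) / 4) 0 1 1 0 0) \<in> U9"
    by (simp add: L_in_U9_iff)
  from U9_isomorphic_iff[OF A[unfolded \<alpha>] this]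
  have "A \<cong>\<^sub>L L (CE_Param (- ((b12 \<alpha> / b11 \<alpha>) ^ 12 * Delta \<alpha>) / 4) 0 1 1 0 0)"
    by (simp add: \<alpha> Delta_def)
  then show "\<exists>c. A \<cong>\<^sub>L L (CE_Param c 0 1 1 0 0)" by blast
qed

end
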